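(* Let $(X,\mathcal{A})$, $(U,\mathcal{F})$ and $(U,\mathcal{G})$ be measurable spaces. Consider the following assertions: (i) $(\mathcal{A}\otimes\mathcal{F})\cap(\mathcal{A}\otimes\mathcal{G})=\mathcal{A}\otimes(\mathcal{F}\cap\mathcal{G})$; (ii) $(\mathcal{A}\otimes\mathcal{F})\cap(\mathcal{A}\otimes\mathcal{G})$ and $\mathcal{A}\otimes(\mathcal{F}\cap\mathcal{G})$ have the same atoms; (iii) all atoms of $(\mathcal{A}\otimes\mathcal{F})\cap(\mathcal{A}\otimes\mathcal{G})$ are Cartesian products (i.e. of the form $C\times D$ with $C\subseteq X$, $D\subseteq U$). Then: (a) (i) implies (ii). (b) If $\mathcal{A}$ and $\mathcal{F}\cap\mathcal{G}$ are atomic, then (ii) implies (iii). (c) Suppose that $\mathcal{S}:=(\mathcal{A}\otimes\mathcal{F})\cap(\mathcal{A}\otimes\mathcal{G})$ is such that $(X\times U,\mathcal{S})$ is strongly Blackwell, or, more generally, that $\mathcal{S}$ is a sub-$\sigma$-algebra of a $\sigma$-algebra $\mathcal{M}$ on $X\times U$ for which $(X\times U,\mathcal{M})$ is strongly Blackwell. If moreover $\mathcal{S}$ is countably generated and $\mathcal{A}\otimes(\mathcal{F}\cap\mathcal{G})$ is countably generated, then (iii) implies (i).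
   Context: For $\sigma$-algebras $\mathcal{C}$ on a set $Y$ and $\mathcal{D}$ on a set $Z$, the product $\mathcal{C}\otimes\mathcal{D}$ is the smallest $\sigma$-algebra on $Y\times Z$ containing all rectangles $C\times D$ with $C\in\mathcal{C}$, $D\in\mathcal{D}$. The underlying sets $X,U$ are nonempty. An atom of a $\sigma$-algebra $\mathcal{C}$ on $Y$ is a nonempty set $K\in\mathcal{C}$ such that no proper nonempty subset of $K$ belongs to $\mathcal{C}$ (no measure is involved). $\mathcal{C}$ is atomic if $Y$ is the union of the atoms of $\mathcal{C}$. A $\sigma$-algebra is countably generated if it is generated by a countable family of sets. A $\sigma$-algebra $\mathcal{C}$ on $Y$ is separated if for any two distinct points $x,y\in Y$ there is $A\in\mathcal{C}$ with $x\in A$ and $y\notin A$. A measurable space $(Y,\mathcal{C})$ is strongly Blackwell if $\mathcal{C}$ is countably generated and separated and any two countably generated sub-$\sigma$-algebras of $\mathcal{C}$ having the same atoms coincide. *)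

theory Defs
  imports "HOL-Analysis.Analysis"
begin

text \<open>
  A \<sigma>-algebra is represented by its ground set together with the family of its members, as in the
  library locale \<^locale>\<open>sigma_algebra\<close>. This allows the intersection of two \<sigma>-algebras on the same
  ground set to be the plain intersection of families of sets.
\<close>

definition product_sigma :: "'a set \<Rightarrow> 'a set set \<Rightarrow> 'b set \<Rightarrow> 'b set set \<Rightarrow> ('a \<times> 'b) set set" where
  "product_sigma Y C Z D = sigma_sets (Y \<times> Z) {A \<times> B | A B. A \<in> C \<and> B \<in> D}"

lemma product_sigma_eq_sets_pair_measure:
  "product_sigma (space M) (sets M) (space N) (sets N) = sets (M \<Otimes>\<^sub>M N)"
  by (simp add: product_sigma_def sets_pair_measure)

definition atoms_of :: "'a set set \<Rightarrow> 'a set set" where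
  "atoms_of C = {K \<in> C. K \<noteq> {} \<and> (\<forall>L\<in>C. L \<subseteq> K \<longrightarrow> L = {} \<or> L = K)}"

definition atomic_sigma :: "'a set \<Rightarrow> 'a set set \<Rightarrow> bool" where
  "atomic_sigma Y C \<longleftrightarrow> Y = \<Union> (atoms_of C)"

definition countably_generated_sigma :: "'a set \<Rightarrow> 'a set set \<Rightarrow> bool" where
  "countably_generated_sigma Y C \<longleftrightarrow> (\<exists>E. countable E \<and> E \<subseteq> Pow Y \<and> C = sigma_sets Y E)"

definition separated_sigma :: "'a set \<Rightarrow> 'a set set \<Rightarrow> bool" where
  "separated_sigma Y C \<longleftrightarrow> (\<forall>x\<in>Y. \<forall>y\<in>Y. x \<noteq> y \<longrightarrow> (\<exists>A\<in>C. x \<in> A \<and> y \<notin> A))"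

definition sub_sigma_algebra :: "'a set \<Rightarrow> 'a set set \<Rightarrow> 'a set set \<Rightarrow> bool" where
  "sub_sigma_algebra Y D C \<longleftrightarrow> sigma_algebra Y D \<and> D \<subseteq> C"

definition strongly_blackwell :: "'a set \<Rightarrow> 'a set set \<Rightarrow> bool" where
  "strongly_blackwell Y C \<longleftrightarrow>
     sigma_algebra Y C \<and> countably_generated_sigma Y C \<and> separated_sigma Y C \<and>
     (\<forall>D E. sub_sigma_algebra Y D C \<longrightarrow> sub_sigma_algebra Y E C \<longrightarrow>
        countably_generated_sigma Y D \<longrightarrow> countably_generated_sigma Y E \<longrightarrow>
        atoms_of D = atoms_of E \<longrightarrow> D = E)"

end

theory Submission
  imports Defs
begin

text \<open>
  Each member of a \<open>\<sigma>\<close>-algebra contains or misses each atom, and this property passes from generators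
  to the generated \<open>\<sigma>\<close>-algebra. So products of atoms are atoms of the product, which gives (b); and
  countably generated \<open>\<sigma>\<close>-algebras are atomic. For (c), an atom \<open>C \<times> D\<close> of \<open>S\<close> has its sections
  \<open>C\<close> in \<open>\<A>\<close> and \<open>D\<close> in both \<open>\<F>\<close> and \<open>\<G>\<close>, so it belongs to \<open>T \<subseteq> S\<close> and is an atom of \<open>T\<close>.
  Since the atoms of \<open>S\<close> cover the space, \<open>T\<close> has no others, and the strong Blackwell property
  forces \<open>S = T\<close>.
\<close>

lemma sigma_sets_subset_or_disjoint:
  assumes "L \<in> sigma_sets Y E" and "K \<subseteq> Y"
    and "\<And>e. e \<in> E \<Longrightarrow> K \<subseteq> e \<or> K \<inter> e = {}"
  shows "K \<subseteq> L \<or> K \<inter> L = {}"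
  using assms(1)
proof induction
  case (Basic a)
  then show ?case by (rule assms(3))
next
  case Empty
  then show ?case by simp
next
  case (Compl a)
  \<comment> \<open>If \<open>K\<close> misses \<open>a\<close>, then \<open>K \<subseteq> Y\<close>
    puts \<open>K\<close> inside \<open>Y - a\<close>.\<close>
  then show ?case using assms(2) by blast
next
  case (Union a)
  then show ?case by blast
qed

lemma atoms_ofI:
  assumes "K \<in> C" "K \<noteq> {}" "\<And>L. L \<in> C \<Longrightarrow> K \<subseteq> L \<or> K \<inter> L = {}"
  shows "K \<in> atoms_of C"
  unfolding atoms_of_def using assms by blast

text \<open>The intersection \<open>K \<inter> L\<close> is a member below \<open>K\<close>, so
  minimality of \<open>K\<close> leaves only the two extremes.\<close>

lemma atoms_of_subset_or_disjoint:
  assumes "sigma_algebra Y C" and "K \<in> atoms_of C" and "L \<in> C"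
  shows "K \<subseteq> L \<or> K \<inter> L = {}"
proof -
  interpret sigma_algebra Y C by fact
  have "K \<inter> L \<in> C" using assms by (auto simp: atoms_of_def)
  moreover have "\<forall>L\<in>C. L \<subseteq> K \<longrightarrow> L = {} \<or> L = K"
    using assms(2) by (simp add: atoms_of_def)
  ultimately have "K \<inter> L = {} \<or> K \<inter> L = K" by simp
  then show ?thesis by blast
qed

lemma atoms_of_eqI:
  assumes "sigma_algebra Y C" and "K \<in> atoms_of C" and "L \<in> atoms_of C" and "K \<inter> L \<noteq> {}"
  shows "K = L"
proof -
  have "K \<in> C" "L \<in> C" using assms(2,3) by (simp_all add: atoms_of_def)
  then have "K \<subseteq> L" "L \<subseteq> K"
    using atoms_of_subset_or_disjoint[OF assms(1,2), of L]
      atoms_of_subset_or_disjoint[OF assms(1,3), of K] assms(4)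
    by (simp_all add: Int_commute)
  then show ?thesis by (rule equalityI)
qed

text \<open>The atom through \<open>x\<close> is the set of points that no generator separates from
  \<open>x\<close>. Every generator contains or misses it, hence so does every member.\<close>

lemma countably_generated_imp_atomic:
  assumes "countably_generated_sigma Y C"
  shows "atomic_sigma Y C"
proof -
  obtain E where E: "countable E" "E \<subseteq> Pow Y" "C = sigma_sets Y E"
    using assms unfolding countably_generated_sigma_def by blast
  interpret sigma_algebra Y C using E sigma_algebra_sigma_sets by blast
  have "\<exists>K\<in>atoms_of C. x \<in> K" if x: "x \<in> Y" for x
  proof -
    define K where "K = {y \<in> Y. \<forall>e\<in>E. y \<in> e \<longleftrightarrow> x \<in> e}"
    have "{y \<in> Y. y \<in> e \<longleftrightarrow> x \<in> e} \<in> C" if "e \<in> E" for e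
    proof (cases "x \<in> e")
      case True
      then have "{y \<in> Y. y \<in> e \<longleftrightarrow> x \<in> e} = e" using that E(2) by auto
      then show ?thesis using that E(3) by auto
    next
      case False
      then have "{y \<in> Y. y \<in> e \<longleftrightarrow> x \<in> e} = Y - e" by auto
      then show ?thesis using that E(3) by (auto intro: sigma_sets.intros)
    qed
    \<comment> \<open>Countability enters here: \<open>K\<close> is the intersection over
      \<open>e \<in> E\<close> of the sets just shown to be members.\<close>
    then have "K \<in> C"
      unfolding K_def by (rule sets_Collect_countable_All'[OF _ E(1)])
    moreover have "x \<in> K" using x by (simp add: K_def)
    moreover have "K \<subseteq> L \<or> K \<inter> L = {}" if "L \<in> C" for L
    proof (rule sigma_sets_subset_or_disjoint)
      show "L \<in> sigma_sets Y E" using that E(3) by simp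
    qed (auto simp: K_def)
    ultimately have "K \<in> atoms_of C" by (intro atoms_ofI) auto
    with \<open>x \<in> K\<close> show ?thesis by blast
  qed
  moreover have "\<Union> (atoms_of C) \<subseteq> Y"
    using space_closed by (auto simp: atoms_of_def)
  ultimately show ?thesis unfolding atomic_sigma_def by blast
qed

text \<open>Minimality among the members of \<open>S\<close> is inherited by the smaller family
  \<open>T\<close>. Conversely, an atom of \<open>T\<close> meets some atom of \<open>S\<close>,
  which is then also an atom of \<open>T\<close>, and distinct atoms are disjoint.\<close>

lemma atoms_of_eq_if_atoms_in_subalgebra:
  assumes "sigma_algebra Y T" and "T \<subseteq> S" and "atomic_sigma Y S" and "atoms_of S \<subseteq> T"
  shows "atoms_of S = atoms_of T"
proof
  show sub: "atoms_of S \<subseteq> atoms_of T"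
    using assms(2,4) unfolding atoms_of_def by blast
  show "atoms_of T \<subseteq> atoms_of S"
  proof
    fix K assume K: "K \<in> atoms_of T"
    then obtain x where x: "x \<in> K" by (auto simp: atoms_of_def)
    have "K \<subseteq> Y"
      using assms(1) K by (auto simp: atoms_of_def sigma_algebra_iff2)
    then obtain L where L: "L \<in> atoms_of S" "x \<in> L"
      using x assms(3) unfolding atomic_sigma_def by blast
    then have "K = L"
      using K sub x by (intro atoms_of_eqI[OF assms(1)]) blast+
    with L show "K \<in> atoms_of S" by simp
  qed
qed

lemma sigma_algebra_product_sigma:
  assumes "C \<subseteq> Pow Y" and "D \<subseteq> Pow Z"
  shows "sigma_algebra (Y \<times> Z) (product_sigma Y C Z D)"
  unfolding product_sigma_def using assms by (intro sigma_algebra_sigma_sets) blast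

lemma sigma_algebra_Int:
  assumes "sigma_algebra Y C" and "sigma_algebra Y D"
  shows "sigma_algebra Y (C \<inter> D)"
  using assms by (simp add: sigma_algebra_iff2 le_infI1)

lemma product_sigma_mono:
  assumes "D \<subseteq> D'"
  shows "product_sigma Y C Z D \<subseteq> product_sigma Y C Z D'"
  unfolding product_sigma_def using assms by (intro sigma_sets_mono') blast

lemma Times_in_product_sigma:
  assumes "A \<in> C" and "B \<in> D"
  shows "A \<times> B \<in> product_sigma Y C Z D"
  unfolding product_sigma_def using assms by (intro sigma_sets.Basic) blast

text \<open>Sections of product-measurable sets are measurable, and a section of a rectangle through
  a point of one side is the other side. Nonemptiness supplies such points.\<close>

lemma product_sigma_Times_sections:
  assumes "sigma_algebra Y C" and "sigma_algebra Z D"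
    and "A \<times> B \<in> product_sigma Y C Z D" and "A \<noteq> {}" and "B \<noteq> {}"
  shows "A \<in> C" and "B \<in> D"
proof -
  \<comment> \<open>Passing to measure spaces makes the section lemmas for \<open>sets\<close>
    available; since \<open>C\<close> and \<open>D\<close> are \<sigma>-algebras,
    \<open>sets\<close> returns them unchanged.\<close>
  let ?M = "sigma Y C" and ?N = "sigma Z D"
  have AB: "A \<times> B \<in> sets (?M \<Otimes>\<^sub>M ?N)"
    using assms product_sigma_eq_sets_pair_measure[of ?M ?N]
    by (simp add: sigma_algebra.sets_measure_of_eq sigma_algebra.space_measure_of_eq)
  obtain a b where ab: "a \<in> A" "b \<in> B" using assms by blast
  have "(\<lambda>x. (x, b)) -` (A \<times> B) = A" "Pair a -` (A \<times> B) = B"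
    using ab by auto
  with sets_Pair2[OF AB, of b] sets_Pair1[OF AB, of a] show "A \<in> C" "B \<in> D"
    using assms by (simp_all add: sigma_algebra.sets_measure_of_eq)
qed

text \<open>For a point \<open>(x, z)\<close> of \<open>K\<close>, the product of the atoms through
  \<open>x\<close> and \<open>z\<close> is itself an atom; it meets \<open>K\<close>, so it equals
  \<open>K\<close>.\<close>

lemma atoms_of_product_sigma:
  assumes C: "sigma_algebra Y C" and D: "sigma_algebra Z D"
    and "atomic_sigma Y C" and "atomic_sigma Z D" and K: "K \<in> atoms_of (product_sigma Y C Z D)"
  obtains A B where "A \<in> atoms_of C" "B \<in> atoms_of D" "K = A \<times> B"
proof -
  interpret C: sigma_algebra Y C by fact
  interpret D: sigma_algebra Z D by fact
  have P: "sigma_algebra (Y \<times> Z) (product_sigma Y C Z D)"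
    using C.space_closed D.space_closed by (rule sigma_algebra_product_sigma)
  obtain x z where xz: "(x, z) \<in> K" using K by (auto simp: atoms_of_def)
  moreover have "K \<subseteq> Y \<times> Z"
    using P K by (auto simp: atoms_of_def sigma_algebra_iff2)
  ultimately obtain A B where A: "A \<in> atoms_of C" "x \<in> A" and B: "B \<in> atoms_of D" "z \<in> B"
    using assms(3,4) unfolding atomic_sigma_def by blast
  then have AB: "A \<in> C" "B \<in> D" by (auto simp: atoms_of_def)
  have "A \<times> B \<in> atoms_of (product_sigma Y C Z D)"
  proof (rule atoms_ofI)
    show "A \<times> B \<in> product_sigma Y C Z D" using AB by (rule Times_in_product_sigma)
    show "A \<times> B \<noteq> {}" using A B by blast
    fix L assume "L \<in> product_sigma Y C Z D"
    then show "A \<times> B \<subseteq> L \<or> A \<times> B \<inter> L = {}"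
      unfolding product_sigma_def
    proof (rule sigma_sets_subset_or_disjoint)
      show "A \<times> B \<subseteq> Y \<times> Z" using AB C.sets_into_space D.sets_into_space by blast
      fix R assume "R \<in> {A \<times> B |A B. A \<in> C \<and> B \<in> D}"
      then obtain A' B' where R: "R = A' \<times> B'" "A' \<in> C" "B' \<in> D" by blast
      \<comment> \<open>If both sides of \<open>R\<close> contain the corresponding atom,
        \<open>R\<close> contains the product; if one side misses its atom, \<open>R\<close> misses
        the product.\<close>
      show "A \<times> B \<subseteq> R \<or> A \<times> B \<inter> R = {}"
        using atoms_of_subset_or_disjoint[OF C A(1) R(2)]
          atoms_of_subset_or_disjoint[OF D B(1) R(3)]
        unfolding R(1) by blast
    qed
  qed
  with K have "K = A \<times> B"
    using xz A B by (intro atoms_of_eqI[OF P]) blast+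
  with A B that show thesis by blast
qed

theorem theorem4p6:
  fixes X :: "'a set" and U :: "'b set"
    and \<A> :: "'a set set" and \<F> \<G> :: "'b set set"
    and S T :: "('a \<times> 'b) set set"
  assumes "X \<noteq> {}" and "U \<noteq> {}"
    and "sigma_algebra X \<A>" and "sigma_algebra U \<F>" and "sigma_algebra U \<G>"
    and S_def: "S = product_sigma X \<A> U \<F> \<inter> product_sigma X \<A> U \<G>"
    and T_def: "T = product_sigma X \<A> U (\<F> \<inter> \<G>)"
  shows "(S = T \<longrightarrow> atoms_of S = atoms_of T) \<and>
    (atomic_sigma X \<A> \<and> atomic_sigma U (\<F> \<inter> \<G>) \<longrightarrow>
      atoms_of S = atoms_of T \<longrightarrow>
      (\<forall>K\<in>atoms_of S. \<exists>C D. C \<subseteq> X \<and> D \<subseteq> U \<and> K = C \<times> D)) \<and>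
    ((strongly_blackwell (X \<times> U) S \<or>
        (\<exists>M. strongly_blackwell (X \<times> U) M \<and> sub_sigma_algebra (X \<times> U) S M)) \<and>
      countably_generated_sigma (X \<times> U) S \<and> countably_generated_sigma (X \<times> U) T \<longrightarrow>
      (\<forall>K\<in>atoms_of S. \<exists>C D. C \<subseteq> X \<and> D \<subseteq> U \<and> K = C \<times> D) \<longrightarrow>
      S = T)"
proof (intro conjI impI)
  assume "S = T"
  then show "atoms_of S = atoms_of T" by simp
next
  assume atomic: "atomic_sigma X \<A> \<and> atomic_sigma U (\<F> \<inter> \<G>)"
    and eq: "atoms_of S = atoms_of T"
  have FG: "sigma_algebra U (\<F> \<inter> \<G>)"
    using assms(4,5) by (rule sigma_algebra_Int)
  show "\<forall>K\<in>atoms_of S. \<exists>C D. C \<subseteq> X \<and> D \<subseteq> U \<and> K = C \<times> D"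
  proof
    fix K assume "K \<in> atoms_of S"
    \<comment> \<open>Equality of the atoms moves the question from \<open>S\<close>, which is only
      an intersection of products, to the genuine product \<open>T\<close>.\<close>
    then have "K \<in> atoms_of (product_sigma X \<A> U (\<F> \<inter> \<G>))"
      using eq T_def by simp
    then obtain C D where "C \<in> atoms_of \<A>" "D \<in> atoms_of (\<F> \<inter> \<G>)" "K = C \<times> D"
      using atomic by (auto elim: atoms_of_product_sigma[OF assms(3) FG])
    then show "\<exists>C D. C \<subseteq> X \<and> D \<subseteq> U \<and> K = C \<times> D"
      using atomic unfolding atomic_sigma_def by blast
  qed
next
  assume hyps: "(strongly_blackwell (X \<times> U) S \<or>
        (\<exists>M. strongly_blackwell (X \<times> U) M \<and> sub_sigma_algebra (X \<times> U) S M)) \<and>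
      countably_generated_sigma (X \<times> U) S \<and> countably_generated_sigma (X \<times> U) T"
    and rect: "\<forall>K\<in>atoms_of S. \<exists>C D. C \<subseteq> X \<and> D \<subseteq> U \<and> K = C \<times> D"
  have "T \<subseteq> S"
    unfolding S_def T_def by (intro Int_greatest product_sigma_mono) auto
  have pow: "\<A> \<subseteq> Pow X" "\<F> \<subseteq> Pow U" "\<G> \<subseteq> Pow U"
    using assms(3-5) by (simp_all add: sigma_algebra_iff2)
  have S: "sigma_algebra (X \<times> U) S"
    unfolding S_def using pow by (intro sigma_algebra_Int sigma_algebra_product_sigma)
  have T: "sigma_algebra (X \<times> U) T"
    unfolding T_def using pow by (intro sigma_algebra_product_sigma) auto
  have "atoms_of S \<subseteq> T"
  proof
    fix K assume K: "K \<in> atoms_of S"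
    from bspec[OF rect K] obtain C D where CD: "K = C \<times> D" by (elim exE conjE)
    have K': "K \<in> S" "K \<noteq> {}" using K by (simp_all add: atoms_of_def)
    then have ne: "C \<noteq> {}" "D \<noteq> {}" using CD by auto
    \<comment> \<open>Each of the two products constrains the side \<open>D\<close> separately,
      which places it in both \<open>\<F>\<close> and \<open>\<G>\<close>.\<close>
    have "C \<times> D \<in> product_sigma X \<A> U \<F>" "C \<times> D \<in> product_sigma X \<A> U \<G>"
      using K'(1) unfolding CD S_def by simp_all
    then have "C \<in> \<A>" "D \<in> \<F> \<inter> \<G>"
      using product_sigma_Times_sections[OF assms(3,4) _ ne]
        product_sigma_Times_sections[OF assms(3,5) _ ne] by simp_all
    then show "K \<in> T"
      unfolding CD T_def by (rule Times_in_product_sigma)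
  qed
  then have "atoms_of S = atoms_of T"
    using hyps
    by (intro atoms_of_eq_if_atoms_in_subalgebra[OF T \<open>T \<subseteq> S\<close>] countably_generated_imp_atomic) auto
  \<comment> \<open>If \<open>S\<close> itself is strongly Blackwell, \<open>M = S\<close> serves,
    so both alternatives are treated at once.\<close>
  moreover obtain M where M: "strongly_blackwell (X \<times> U) M" "S \<subseteq> M"
    using hyps unfolding sub_sigma_algebra_def by (elim conjE disjE exE) auto
  moreover have "sub_sigma_algebra (X \<times> U) S M" "sub_sigma_algebra (X \<times> U) T M"
    using S T M(2) \<open>T \<subseteq> S\<close> by (auto simp: sub_sigma_algebra_def)
  ultimately show "S = T"
    using hyps unfolding strongly_blackwell_def by simp
qed

end
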